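(* Let $B$ be a finite set of permutations. The following are equivalent: (1) $\operatorname{Av}(B)$ contains only finitely many vertical alternations; (2) there is an integer $k$ such that no valid configuration for $\operatorname{Av}(B)$ has more than $k$ slots; (3) every sufficiently long valid configuration for $\operatorname{Av}(B)$ contains an IE-reducible entry (relative to $B$), i.e. there is an integer $N$ such that every valid configuration for $\operatorname{Av}(B)$ of length at least $N$ contains an IE-reducible entry; (4) the insertion encoding of $\operatorname{Av}(B)$ is regular.
   Context: **Permutations and classes.** Permutations are written in one-line notation. For a sequence $w$ of distinct natural numbers, its standardization $\operatorname{st}(w)$ is the unique permutation of the same length having the same pairwise comparisons. A permutation $\pi$ contains $\beta$ if some (not necessarily contiguous) subsequence of $\pi$ has standardization $\beta$; otherwise $\pi$ avoids $\beta$. $\operatorname{Av}(B)$ is the set of all permutations avoiding every element of $B$. **Vertical alternations.** A vertical alternation is a permutation in which either every entry of even index is greater than every entry of odd index, or every entry of odd index is greater than every entry of even index. **Configurations.** A configuration is a word consisting of the entries of a permutation (its underlying permutation, in one-line order), interspersed with zero or more symbols $\diamond$, called slots, such that no two slots are adjacent. The slots are numbered $1,2,\dots$ from left to right. The length of a configuration is the length of this word, slots included, and $c(i)$ denotes the $i$th symbol of the configuration $c$. Slotless configurations are identified with permutations. **Insertions.** If a configuration has underlying permutation of length $n-1$ and has an $i$th slot, then a new maximum entry $n$ may be inserted in that slot by one of four operations: - $\mathbf{m}_i$ replaces the $i$th $\diamond$ with $\diamond\, n\, \diamond$; - $\mathbf{l}_i$ replaces it with $n\,\diamond$; - $\mathbf{r}_i$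 replaces it with $\diamond\, n$; - $\mathbf{f}_i$ replaces it with $n$. A word in these symbols is applied to a configuration by performing its operations successively from left to right (when each is defined). **Insertion encoding.** Every nonempty permutation arises from the initial configuration $\diamond$ by a unique such word, called its insertion encoding; for example, the insertion encoding of $423615$ is $\mathbf{m}_1\mathbf{m}_2\mathbf{l}_2\mathbf{f}_1\mathbf{f}_2\mathbf{f}_1$. The insertion encoding of $\operatorname{Av}(B)$ is the language of all insertion encodings of (nonempty) elements of $\operatorname{Av}(B)$. It is regular if it uses only finitely many of the symbols $\mathbf{m}_i,\mathbf{l}_i,\mathbf{r}_i,\mathbf{f}_i$ and is accepted by a finite automaton over a finite alphabet of such symbols. **Validity.** A configuration is valid for $\operatorname{Av}(B)$ if some (possibly empty) word of insertions transforms it into a slotless configuration that is a permutation in $\operatorname{Av}(B)$. **IE-reducibility.** Two configurations $c,d$ are distinguished (relative to $B$) by a word $w$ if applying $w$ to one of them is defined and yields a slotless configuration in $\operatorname{Av}(B)$, while this fails for the other. They are indistinguishable if no word distinguishes them. For a configuration $c$ and an entry $c(i)$, let $c-c(i)$ be the result of deleting $c(i)$, and let $\operatorname{st}(c-c(i))$ be the configuration obtained by standardizing the remaining numerical entries while keeping the slots in place, e.g. $\operatorname{st}(9\diamond 1672\,\diamond)=5\diamond 1342\,\diamond$. In a valid configuration $c$ for $\operatorname{Av}(B)$, the entry $c(i)$ is IE-reducible (relative to $B$) if $c$ is indistinguishable from $\operatorname{st}(c-c(i))$. By convention, $c(i)$ is never IE-reducible if it is a $\diamond$ or if it has a $\diamond$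 immediately on each of its two sides, since deleting it would change the number of slots. *)

theory Defs
  imports Main "HOL-Library.Sublist"
begin

section \<open>Permutations and classes\<close>

definition is_perm :: "nat list \<Rightarrow> bool" where
  "is_perm p \<longleftrightarrow> distinct p \<and> set p = {1..length p}"

definition rank :: "nat set \<Rightarrow> nat \<Rightarrow> nat" where
  "rank A a = card {b \<in> A. b \<le> a}"

text \<open>Only meaningful for sequences of distinct entries.\<close>

definition st :: "nat list \<Rightarrow> nat list" where
  "st w = map (rank (set w)) w"

definition contains :: "nat list \<Rightarrow> nat list \<Rightarrow> bool" where
  "contains p \<beta> \<longleftrightarrow> (\<exists>s. subseq s p \<and> st s = \<beta>)"

definition Av :: "nat list set \<Rightarrow> nat list set" where
  "Av B = {p. is_perm p \<and> (\<forall>\<beta>\<in>B. \<not> contains p \<beta>)}"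

text \<open>List positions start at 0 instead of 1; since the two disjuncts are exchanged by
  swapping parities, this does not affect the notion.\<close>

definition vertical_alternation :: "nat list \<Rightarrow> bool" where
  "vertical_alternation p \<longleftrightarrow> is_perm p \<and>
     ((\<forall>i < length p. \<forall>j < length p. even i \<and> odd j \<longrightarrow> p ! i > p ! j) \<or>
      (\<forall>i < length p. \<forall>j < length p. even i \<and> odd j \<longrightarrow> p ! i < p ! j))"

section \<open>Configurations and insertions\<close>

datatype symbol = Slot | Entry nat

fun entries :: "symbol list \<Rightarrow> nat list" where
  "entries [] = []"
| "entries (Slot # c) = entries c"
| "entries (Entry a # c) = a # entries c"

definition num_slots :: "symbol list \<Rightarrow> nat" where
  "num_slots c = count_list c Slot"

definition configuration :: "symbol list \<Rightarrow> bool" where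
  "configuration c \<longleftrightarrow>
     is_perm (entries c) \<and> successively (\<lambda>x y. \<not> (x = Slot \<and> y = Slot)) c"

text \<open>Slots are numbered from 1; the result is \<^term>\<open>None\<close> if there is no slot with
  the given number (in particular for number 0).\<close>

fun replace_slot :: "nat \<Rightarrow> symbol list \<Rightarrow> symbol list \<Rightarrow> symbol list option" where
  "replace_slot i ys [] = None"
| "replace_slot i ys (Entry a # c) = map_option ((#) (Entry a)) (replace_slot i ys c)"
| "replace_slot i ys (Slot # c) =
     (if i = 1 then Some (ys @ c) else map_option ((#) Slot) (replace_slot (i - 1) ys c))"

text \<open>The constructors stand for the operations \<open>m\<close>, \<open>l\<close>, \<open>r\<close>, \<open>f\<close>, respectively.\<close>

datatype insertion = Middle nat | Left nat | Right nat | Fill nat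

fun insert_max :: "insertion \<Rightarrow> symbol list \<Rightarrow> symbol list option" where
  "insert_max (Middle i) c = replace_slot i [Slot, Entry (length (entries c) + 1), Slot] c"
| "insert_max (Left i) c = replace_slot i [Entry (length (entries c) + 1), Slot] c"
| "insert_max (Right i) c = replace_slot i [Slot, Entry (length (entries c) + 1)] c"
| "insert_max (Fill i) c = replace_slot i [Entry (length (entries c) + 1)] c"

fun apply_word :: "insertion list \<Rightarrow> symbol list \<Rightarrow> symbol list option" where
  "apply_word [] c = Some c"
| "apply_word (x # w) c = Option.bind (insert_max x c) (apply_word w)"

definition completes :: "nat list set \<Rightarrow> insertion list \<Rightarrow> symbol list \<Rightarrow> bool" where
  "completes B w c \<longleftrightarrow> (\<exists>p\<in>Av B. apply_word w c = Some (map Entry p))"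

definition valid :: "nat list set \<Rightarrow> symbol list \<Rightarrow> bool" where
  "valid B c \<longleftrightarrow> configuration c \<and> (\<exists>w. completes B w c)"

section \<open>Insertion encoding\<close>

definition is_insertion_encoding :: "insertion list \<Rightarrow> nat list \<Rightarrow> bool" where
  "is_insertion_encoding w p \<longleftrightarrow> apply_word w [Slot] = Some (map Entry p)"

lemma "is_insertion_encoding [Middle 1, Middle 1, Left 2, Fill 1, Fill 2, Fill 1] [4,2,3,6,1,5]"
  by (simp add: is_insertion_encoding_def)

definition insertion_encodings :: "nat list set \<Rightarrow> insertion list set" where
  "insertion_encodings B = {w. \<exists>p\<in>Av B. p \<noteq> [] \<and> is_insertion_encoding w p}"

text \<open>Acceptance by a deterministic finite automaton over a finite alphabet \<open>\<Sigma>\<close>.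
  Taking the states to be natural numbers loses no generality, as there are finitely many.\<close>

definition regular :: "'a list set \<Rightarrow> bool" where
  "regular L \<longleftrightarrow>
     (\<exists>(\<Sigma> :: 'a set) (Q :: nat set) \<delta> q\<^sub>0 F.
        finite \<Sigma> \<and> finite Q \<and> q\<^sub>0 \<in> Q \<and> F \<subseteq> Q \<and> (\<forall>q\<in>Q. \<forall>a\<in>\<Sigma>. \<delta> q a \<in> Q) \<and>
        L = {w \<in> lists \<Sigma>. foldl \<delta> q\<^sub>0 w \<in> F})"

section \<open>IE-reducibility\<close>

definition distinguishes ::
    "nat list set \<Rightarrow> insertion list \<Rightarrow> symbol list \<Rightarrow> symbol list \<Rightarrow> bool" where
  "distinguishes B w c d \<longleftrightarrow> completes B w c \<noteq> completes B w d"

definition indistinguishable :: "nat list set \<Rightarrow> symbol list \<Rightarrow> symbol list \<Rightarrow> bool" where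
  "indistinguishable B c d \<longleftrightarrow> (\<nexists>w. distinguishes B w c d)"

fun map_entry :: "(nat \<Rightarrow> nat) \<Rightarrow> symbol \<Rightarrow> symbol" where
  "map_entry f Slot = Slot"
| "map_entry f (Entry a) = Entry (f a)"

definition st_config :: "symbol list \<Rightarrow> symbol list" where
  "st_config c = map (map_entry (rank (set (entries c)))) c"

lemma "st_config [Entry 9, Slot, Entry 1, Entry 6, Entry 7, Entry 2, Slot] =
    [Entry 5, Slot, Entry 1, Entry 3, Entry 4, Entry 2, Slot]"
  by code_simp

definition delete_at :: "nat \<Rightarrow> 'a list \<Rightarrow> 'a list" where
  "delete_at i c = take i c @ drop (Suc i) c"

definition between_slots :: "symbol list \<Rightarrow> nat \<Rightarrow> bool" where
  "between_slots c i \<longleftrightarrow>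
     0 < i \<and> Suc i < length c \<and> c ! (i - 1) = Slot \<and> c ! Suc i = Slot"

text \<open>Here \<open>i\<close> is a list position, starting at 0.\<close>

definition IE_reducible :: "nat list set \<Rightarrow> symbol list \<Rightarrow> nat \<Rightarrow> bool" where
  "IE_reducible B c i \<longleftrightarrow>
     valid B c \<and> i < length c \<and> c ! i \<noteq> Slot \<and> \<not> between_slots c i \<and>
     indistinguishable B c (st_config (delete_at i c))"

end

theory Submission
  imports Defs
begin

text \<open>A completion of a configuration puts a nonempty sequence of larger entries into every slot,
  and consecutive slots are separated by an entry, so many slots yield a long vertical alternation.
  Conversely, replacing the upper half of a vertical alternation by slots gives a valid
  configuration with many slots.

  If the number of slots is bounded, an occurrence of a basis element in a completion is determined,
  up to order isomorphism, by its part in the completed material and by the standardization of its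
  old entries together with all slots. There are finitely many such patterns; choosing one witness
  for each that occurs, every entry that lies outside the witnesses and not between two slots is
  IE-reducible. Removing reducible entries keeps the slots and leaves finitely many short
  configurations up to indistinguishability, and these are the states of an automaton.\<close>

section \<open>Standardization\<close>

lemma subseq_set: "subseq s p \<Longrightarrow> set s \<subseteq> set p"
  by (induction rule: list_emb.induct) auto

lemma subseq_distinct: "subseq s p \<Longrightarrow> distinct p \<Longrightarrow> distinct s"
  by (auto simp: subseq_conv_nths)

lemma rank_strict_mono: "finite A \<Longrightarrow> strict_mono_on A (rank A)"
  unfolding rank_def
proof (rule strict_mono_onI, rule psubset_card_mono)
  fix r s assume "r \<in> A" "s \<in> A" "r < s"
  then have "s \<in> {b \<in> A. b \<le> s} - {b \<in> A. b \<le> r}" by simp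
  then show "{b \<in> A. b \<le> r} \<subset> {b \<in> A. b \<le> s}" using \<open>r < s\<close> by force
qed auto

lemma rank_image:
  assumes "strict_mono_on A f" "x \<in> A"
  shows "rank (f ` A) (f x) = rank A x"
proof -
  have "{b \<in> f ` A. b \<le> f x} = f ` {b \<in> A. b \<le> x}"
    using assms by (auto simp: strict_mono_on_less_eq)
  moreover have "inj_on f {b \<in> A. b \<le> x}"
    using strict_mono_on_imp_inj_on[OF assms(1)] by (rule inj_on_subset) auto
  ultimately show ?thesis by (simp add: rank_def card_image)
qed

lemma st_map: "strict_mono_on (set s) f \<Longrightarrow> st (map f s) = st s"
  by (simp add: st_def rank_image)

lemma length_st [simp]: "length (st s) = length s"
  by (simp add: st_def)

lemma rank_bounds: "finite A \<Longrightarrow> x \<in> A \<Longrightarrow> rank A x \<in> {1..card A}"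
  unfolding rank_def by (auto simp: Suc_le_eq card_gt_0_iff intro: card_mono)

lemma is_perm_st:
  assumes "distinct s" shows "is_perm (st s)"
proof -
  have inj: "inj_on (rank (set s)) (set s)"
    by (rule strict_mono_on_imp_inj_on, rule rank_strict_mono) simp
  have "rank (set s) ` set s = {1..length s}"
  proof (rule card_subset_eq)
    show "rank (set s) ` set s \<subseteq> {1..length s}"
      using rank_bounds[of "set s"] assms distinct_card[of s] by fastforce
  qed (simp_all add: card_image inj distinct_card assms)
  then show ?thesis using inj assms by (simp add: is_perm_def st_def distinct_map)
qed

lemma contains_map:
  assumes "strict_mono_on (set s) f"
  shows "contains (map f s) \<beta> \<longleftrightarrow> contains s \<beta>"
proof
  assume "contains (map f s) \<beta>"
  then obtain t where t: "subseq t (map f s)" "st t = \<beta>" by (auto simp: contains_def)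
  obtain I where "t = nths (map f s) I" using t(1) by (auto simp: subseq_conv_nths)
  then have *: "t = map f (nths s I)" by (simp add: nths_map)
  have "strict_mono_on (set (nths s I)) f"
    using assms by (rule monotone_on_subset) (rule set_nths_subset)
  then have "st t = st (nths s I)" unfolding * by (rule st_map)
  then show "contains s \<beta>" using t(2) by (auto simp: contains_def subseq_conv_nths)
next
  assume "contains s \<beta>"
  then obtain t where t: "subseq t s" "st t = \<beta>" by (auto simp: contains_def)
  have "st (map f t) = \<beta>"
    using st_map[OF monotone_on_subset[OF assms subseq_set[OF t(1)]]] t(2) by simp
  then show "contains (map f s) \<beta>" using t(1) by (auto simp: contains_def intro: subseq_map)
qed

lemma contains_subseq: "contains s \<beta> \<Longrightarrow> subseq s p \<Longrightarrow> contains p \<beta>"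
  by (auto simp: contains_def dest: subseq_order.trans)

lemma st_in_Av_iff:
  assumes "distinct s"
  shows "st s \<in> Av B \<longleftrightarrow> (\<forall>\<beta>\<in>B. \<not> contains s \<beta>)"
  using contains_map[OF rank_strict_mono, of s] is_perm_st[OF assms] by (simp add: Av_def st_def)

text \<open>Downward closure of the class. It keeps extracted alternations inside the class and
  makes deleting an entry from a completion harmless.\<close>

lemma st_in_Av: "p \<in> Av B \<Longrightarrow> subseq s p \<Longrightarrow> st s \<in> Av B"
  using st_in_Av_iff[OF subseq_distinct, of s p] contains_subseq[of s _ p]
  by (auto simp: Av_def is_perm_def)

section \<open>Insertions\<close>

lemma entries_append [simp]: "entries (c @ d) = entries c @ entries d"
  by (induction c rule: entries.induct) auto

lemma entries_map_Entry [simp]: "entries (map Entry p) = p"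
  by (induction p) auto

lemma in_set_entries [simp]: "a \<in> set (entries c) \<longleftrightarrow> Entry a \<in> set c"
  by (induction c rule: entries.induct) auto

lemma num_slots_simps [simp]:
  "num_slots [] = 0" "num_slots (Slot # c) = Suc (num_slots c)"
  "num_slots (Entry a # c) = num_slots c" "num_slots (c @ d) = num_slots c + num_slots d"
  by (simp_all add: num_slots_def)

lemma num_slots_map_Entry [simp]: "num_slots (map Entry p) = 0"
  by (induction p) auto

lemma length_eq_entries_slots: "length c = length (entries c) + num_slots c"
  by (induction c rule: entries.induct) auto

lemma slotless_eq_map_Entry: "Slot \<notin> set c \<Longrightarrow> c = map Entry (entries c)"
  by (induction c rule: entries.induct) auto

text \<open>Replaces the recursion by a factorization of the configuration at the chosen slot, whose
  number is one more than the number of slots before it.\<close>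

lemma replace_slot_eq_Some_iff:
  "replace_slot i ys c = Some d \<longleftrightarrow>
     (\<exists>u v. c = u @ Slot # v \<and> d = u @ ys @ v \<and> i = Suc (num_slots u))"
proof (induction i ys c arbitrary: d rule: replace_slot.induct)
  case (2 i ys a c)
  show ?case
  proof
    assume "\<exists>u v. Entry a # c = u @ Slot # v \<and> d = u @ ys @ v \<and> i = Suc (num_slots u)"
    then obtain u v where "c = u @ Slot # v" "d = Entry a # u @ ys @ v" "i = Suc (num_slots u)"
      by (auto simp: Cons_eq_append_conv)
    then show "replace_slot i ys (Entry a # c) = Some d" using 2[of "u @ ys @ v"] by auto
  next
    assume "replace_slot i ys (Entry a # c) = Some d"
    then obtain e where "replace_slot i ys c = Some e" "d = Entry a # e" by auto
    then obtain u v where "c = u @ Slot # v" "e = u @ ys @ v" "i = Suc (num_slots u)"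
      using 2 by auto
    then show "\<exists>u v. Entry a # c = u @ Slot # v \<and> d = u @ ys @ v \<and> i = Suc (num_slots u)"
      using \<open>d = _\<close> by (intro exI[of _ "Entry a # u"] exI[of _ v]) auto
  qed
next
  case (3 i ys c)
  show ?case
  proof (cases "i = 1")
    case True
    have "\<not> (\<exists>u v. c = u @ Slot # v \<and> Suc 0 = num_slots (Slot # u) + 1)"
      by simp
    with True show ?thesis
      by (fastforce simp: Cons_eq_append_conv)
  next
    case False
    show ?thesis
    proof
      assume "\<exists>u v. Slot # c = u @ Slot # v \<and> d = u @ ys @ v \<and> i = Suc (num_slots u)"
      then obtain u v where uv: "Slot # c = u @ Slot # v" "d = u @ ys @ v" "i = Suc (num_slots u)"
        by blast
      then obtain u' where "u = Slot # u'" using False by (cases u) auto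
      with uv obtain u where "c = u @ Slot # v" "d = Slot # u @ ys @ v" "i - 1 = Suc (num_slots u)"
        by auto
      then show "replace_slot i ys (Slot # c) = Some d" using False 3[of "u @ ys @ v"] by auto
    next
      assume "replace_slot i ys (Slot # c) = Some d"
      then obtain e where "replace_slot (i - 1) ys c = Some e" "d = Slot # e"
        using False by auto
      then obtain u v where "c = u @ Slot # v" "e = u @ ys @ v" "i - 1 = Suc (num_slots u)"
        using "3.IH"[OF False, of e] by blast
      then show "\<exists>u v. Slot # c = u @ Slot # v \<and> d = u @ ys @ v \<and> i = Suc (num_slots u)"
        using \<open>d = _\<close> by (intro exI[of _ "Slot # u"] exI[of _ v]) auto
    qed
  qed
qed auto

text \<open>Separating the slot number from the inserted symbols (\<open>block\<close>) allows the
  four operations to be treated uniformly.\<close>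

fun slot_index :: "insertion \<Rightarrow> nat" where
  "slot_index (Middle i) = i"
| "slot_index (Left i) = i"
| "slot_index (Right i) = i"
| "slot_index (Fill i) = i"

fun block :: "insertion \<Rightarrow> nat \<Rightarrow> symbol list" where
  "block (Middle i) n = [Slot, Entry n, Slot]"
| "block (Left i) n = [Entry n, Slot]"
| "block (Right i) n = [Slot, Entry n]"
| "block (Fill i) n = [Entry n]"

lemma insert_max_eq:
  "insert_max x c = replace_slot (slot_index x) (block x (Suc (length (entries c)))) c"
  by (cases x) auto

lemma insert_max_eq_Some_iff:
  "insert_max x c = Some d \<longleftrightarrow>
     (\<exists>u v. c = u @ Slot # v \<and> d = u @ block x (Suc (length (entries c))) @ v \<and>
        slot_index x = Suc (num_slots u))"
  by (simp add: insert_max_eq replace_slot_eq_Some_iff)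

lemma entries_block [simp]: "entries (block x n) = [n]"
  by (cases x) auto

lemma apply_word_append:
  "apply_word (v @ w) c = Option.bind (apply_word v c) (apply_word w)"
proof (induction v arbitrary: c)
  case (Cons x v)
  then show ?case by (cases "insert_max x c") auto
qed simp

lemma is_perm_snoc_max:
  "is_perm (u @ Suc (length (u @ v)) # v) \<longleftrightarrow> is_perm (u @ v)"
proof -
  let ?m = "Suc (length (u @ v))"
  have 1: "{1..length (u @ ?m # v)} = insert ?m {1..length (u @ v)}"
    by auto
  have 2: "set (u @ ?m # v) = insert ?m (set (u @ v))" by simp
  show ?thesis
  \<comment> \<open>If the new value occurs already, neither side is a permutation: one has a
    repeated entry, the other an entry above its length.\<close>
  proof (cases "Suc (length u + length v) \<in> set u \<union> set v")
    case True
    have "\<not> is_perm (u @ v)"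
    proof
      assume "is_perm (u @ v)"
      then have "set (u @ v) = {1..length (u @ v)}" by (simp only: is_perm_def)
      with True have "Suc (length u + length v) \<in> {1..length (u @ v)}" by (metis set_append)
      then show False by simp
    qed
    moreover have "\<not> is_perm (u @ Suc (length (u @ v)) # v)"
      using True by (auto simp: is_perm_def)
    ultimately show ?thesis by blast
  next
    case False
    then have "?m \<notin> set (u @ v)" by simp
    moreover have "?m \<notin> {1..length (u @ v)}" by simp
    moreover have "distinct (u @ ?m # v) \<longleftrightarrow> distinct (u @ v)" using False by auto
    moreover have "insert ?m (set (u @ v)) = insert ?m {1..length (u @ v)} \<longleftrightarrow>
        set (u @ v) = {1..length (u @ v)}"
      using calculation by (intro insert_ident)
    ultimately show ?thesis unfolding is_perm_def 1 2 by blast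
  qed
qed

lemma configuration_insert_max:
  assumes "insert_max x c = Some d" "configuration c"
  shows "configuration d"
proof -
  obtain u v where c: "c = u @ Slot # v" and d: "d = u @ block x (Suc (length (entries c))) @ v"
    using assms(1) by (auto simp: insert_max_eq_Some_iff)
  have "is_perm (entries d)"
    using assms(2) is_perm_snoc_max[of "entries u" "entries v"]
    by (simp add: c d configuration_def)
  then show ?thesis
    using assms(2) by (cases x) (auto simp: c d configuration_def successively_append_iff
        successively_Cons)
qed

lemma configuration_apply_word:
  "apply_word w c = Some d \<Longrightarrow> configuration c \<Longrightarrow> configuration d"
proof (induction w arbitrary: c)
  case (Cons x w)
  then show ?case by (auto simp: bind_eq_Some_conv dest: configuration_insert_max)
qed simp

lemma length_entries_apply_word:
  "apply_word w c = Some d \<Longrightarrow> length (entries d) = length (entries c) + length w"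
proof (induction w arbitrary: c)
  case (Cons x w)
  then obtain e where "insert_max x c = Some e" "apply_word w e = Some d"
    by (auto simp: bind_eq_Some_conv)
  then show ?case using Cons.IH[of e] by (auto simp: insert_max_eq_Some_iff)
qed simp

text \<open>An insertion removes at most one slot. For a slotless result this bounds the number of
  slots by the length of the word.\<close>

lemma num_slots_apply_word:
  "apply_word w c = Some d \<Longrightarrow> num_slots c \<le> num_slots d + length w"
proof (induction w arbitrary: c)
  case (Cons x w)
  then obtain e where e: "insert_max x c = Some e" "apply_word w e = Some d"
    by (auto simp: bind_eq_Some_conv)
  have "num_slots c \<le> Suc (num_slots e)" using e(1) by (auto simp: insert_max_eq_Some_iff)
  then show ?case using Cons.IH[OF e(2)] by simp
qed simp

section \<open>Undoing insertions\<close>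

lemma insert_max_inverse:
  assumes "configuration c" "entries c \<noteq> []"
  obtains x d where "configuration d" "insert_max x d = Some c"
    "length (entries c) = Suc (length (entries d))"
proof -
  define n where "n = length (entries c)"
  have "n \<in> set (entries c)"
    using assms by (auto simp: configuration_def is_perm_def n_def Suc_le_eq simp del: in_set_entries)
  then obtain u v where c: "c = u @ Entry n # v" by (metis in_set_entries split_list)
  \<comment> \<open>The maximum is removed together with the slots touching it. What remains on the
    left does not end in a slot, and what remains on the right does not begin with one, so that a
    single slot can join the two.\<close>
  obtain u0 us where u: "u = u0 @ us" "us = [] \<or> us = [Slot]" "u0 = [] \<or> last u0 \<noteq> Slot"
  proof (cases "u \<noteq> [] \<and> last u = Slot")
    case True
    then obtain u0 where u0: "u = u0 @ [Slot]" by (metis append_butlast_last_id)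
    then have "u0 = [] \<or> last u0 \<noteq> Slot"
      using assms(1) by (auto simp: c configuration_def successively_append_iff)
    with u0 show ?thesis using that[of u0 "[Slot]"] by simp
  next
    case False
    then show ?thesis using that[of u "[]"] by auto
  qed
  obtain v0 vs where v: "v = vs @ v0" "vs = [] \<or> vs = [Slot]" "v0 = [] \<or> hd v0 \<noteq> Slot"
  proof (cases "v \<noteq> [] \<and> hd v = Slot")
    case True
    then obtain v0 where v0: "v = [Slot] @ v0" by (cases v) auto
    then have "v0 = [] \<or> hd v0 \<noteq> Slot"
      using assms(1) by (auto simp: c configuration_def successively_append_iff successively_Cons)
    with v0 show ?thesis using that[of "[Slot]" v0] by simp
  next
    case False
    then show ?thesis using that[of "[]" v] by auto
  qed
  \<comment> \<open>The operation is read off from which neighbours of the maximum are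
    slots.\<close>
  define x where "x = (if us = [] then if vs = [] then Fill (Suc (num_slots u0))
      else Left (Suc (num_slots u0)) else if vs = [] then Right (Suc (num_slots u0))
      else Middle (Suc (num_slots u0)))"
  define d where "d = u0 @ Slot # v0"
  have uv: "entries u = entries u0" "entries v = entries v0"
    using u(2) v(2) unfolding u(1) v(1) by auto
  have n: "n = Suc (length (entries d))" using n_def by (simp add: c d_def uv)
  have "us @ Entry n # vs = block x n" using u(2) v(2) by (auto simp: x_def)
  then have "c = u0 @ block x n @ v0" using c u(1) v(1) by simp
  moreover have "slot_index x = Suc (num_slots u0)" by (simp add: x_def)
  ultimately have ins: "insert_max x d = Some c"
    unfolding insert_max_eq_Some_iff using n
    by (intro exI[of _ u0] exI[of _ v0]) (simp add: d_def)
  have succ: "successively (\<lambda>x y. \<not> (x = Slot \<and> y = Slot)) u0"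
    "successively (\<lambda>x y. \<not> (x = Slot \<and> y = Slot)) v0"
    using assms(1) unfolding configuration_def c u(1) v(1)
    by (auto simp: successively_append_iff successively_Cons)
  have "is_perm (entries d)"
    using assms(1) is_perm_snoc_max[of "entries u0" "entries v0"] n
    by (simp add: configuration_def c d_def uv)
  then have "configuration d"
    using succ u(3) v(3) by (auto simp: configuration_def d_def successively_append_iff successively_Cons)
  then show thesis using that[of d x] ins n[unfolded n_def] by blast
qed

text \<open>Maxima are removed one at a time. The case \<open>j = 0\<close> gives reachability;
  other values of \<open>j\<close> cut a permutation at a given height.\<close>

lemma configuration_predecessor:
  assumes "configuration c" "j \<le> length (entries c)"
  shows "\<exists>d w. configuration d \<and> length (entries d) = j \<and> apply_word w d = Some c"
  using assms
proof (induction "length (entries c) - j" arbitrary: c)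
  case 0
  then show ?case by (intro exI[of _ c] exI[of _ "[]"]) auto
next
  case (Suc m)
  then have "entries c \<noteq> []" by auto
  with Suc.prems obtain x e where e: "configuration e" "insert_max x e = Some c"
    "length (entries c) = Suc (length (entries e))" by (metis insert_max_inverse)
  then have "m = length (entries e) - j" "j \<le> length (entries e)" using Suc.hyps(2) by auto
  then obtain d w where "configuration d" "length (entries d) = j" "apply_word w d = Some e"
    using Suc.hyps(1) e(1) by blast
  then show ?case using e by (intro exI[of _ d] exI[of _ "w @ [x]"]) (auto simp: apply_word_append)
qed

text \<open>Undoing all insertions leaves no entries, and slots are never adjacent, so the result is
  \<open>[]\<close> or \<open>[Slot]\<close>; no insertion applies to \<open>[]\<close>.\<close>

lemma configuration_reachable:
  assumes "configuration c" "c \<noteq> []"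
  shows "\<exists>w. apply_word w [Slot] = Some c"
proof -
  obtain d w where d: "configuration d" "entries d = []" "apply_word w d = Some c"
    using configuration_predecessor[OF assms(1), of 0] by auto
  have slot: "x = Slot" if "x \<in> set d" for x
    using that d(2) by (metis in_set_entries empty_iff list.set(1) symbol.exhaust)
  have "d \<noteq> []"
  proof
    assume "d = []"
    with d(3) assms(2) show False
      by (cases w) (auto simp: insert_max_eq bind_eq_Some_conv)
  qed
  then obtain x e where e: "d = x # e" by (cases d) auto
  have "e = []"
  proof (cases e)
    case (Cons y e')
    then show ?thesis using d(1) slot[of x] slot[of y] by (auto simp: e configuration_def)
  qed
  then have "d = [Slot]" using e slot[of x] by simp
  with d(3) show ?thesis by auto
qed

section \<open>Filling all slots at once\<close>

text \<open>Contents beyond the number of slots are ignored, so the first part of a concatenation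
  may be given the whole list. With too few contents \<open>hd []\<close> is unspecified, hence the
  length assumptions where the contents matter.\<close>

fun fill_slots :: "symbol list \<Rightarrow> nat list list \<Rightarrow> nat list" where
  "fill_slots [] Ls = []"
| "fill_slots (Entry a # c) Ls = a # fill_slots c Ls"
| "fill_slots (Slot # c) Ls = hd Ls @ fill_slots c (tl Ls)"

lemma fill_slots_append:
  "fill_slots (c @ d) Ls = fill_slots c Ls @ fill_slots d (drop (num_slots c) Ls)"
  by (induction c Ls rule: fill_slots.induct) (auto simp: drop_Suc)

lemma fill_slots_take: "num_slots c \<le> k \<Longrightarrow> fill_slots c (take k Ls) = fill_slots c Ls"
proof (induction c Ls arbitrary: k rule: fill_slots.induct)
  case (3 c Ls)
  then obtain m where "k = Suc m" by (cases k) auto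
  with 3 show ?case by (cases Ls) auto
qed auto

lemma fill_slots_slotless [simp]: "fill_slots (map Entry p) Ls = p"
  by (induction p) auto

definition large_fills :: "nat \<Rightarrow> nat \<Rightarrow> nat list list \<Rightarrow> bool" where
  "large_fills n k Ls \<longleftrightarrow> length Ls = k \<and> (\<forall>L\<in>set Ls. L \<noteq> [] \<and> (\<forall>a\<in>set L. n < a))"

lemma set_fill_slots:
  "length Ls = num_slots c \<Longrightarrow> set (fill_slots c Ls) = set (entries c) \<union> (\<Union>L\<in>set Ls. set L)"
proof (induction c Ls rule: fill_slots.induct)
  case (3 c Ls)
  then show ?case by (cases Ls) auto
qed auto

text \<open>By induction on the word: what finally replaces the slot used by the first insertion is
  the new entry together with the final contents of the slots placed beside it.\<close>

lemma apply_word_fill_slots: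
  "apply_word w c = Some (map Entry p) \<Longrightarrow>
     \<exists>Ls. large_fills (length (entries c)) (num_slots c) Ls \<and> p = fill_slots c Ls"
proof (induction w arbitrary: c)
  case Nil
  then show ?case by (intro exI[of _ "[]"]) (auto simp: large_fills_def)
next
  case (Cons x w)
  define n where "n = length (entries c)"
  obtain d where d: "insert_max x c = Some d" "apply_word w d = Some (map Entry p)"
    using Cons.prems by (auto simp: bind_eq_Some_conv)
  obtain u v where uv: "c = u @ Slot # v" "d = u @ block x (Suc n) @ v"
    using d(1) by (auto simp: insert_max_eq_Some_iff n_def)
  have n': "length (entries d) = Suc n" by (simp add: uv n_def)
  obtain Ls where Ls: "large_fills (Suc n) (num_slots d) Ls" "p = fill_slots d Ls"
    using Cons.IH[OF d(2)] n' by auto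
  \<comment> \<open>\<open>A\<close>, \<open>M\<close> and \<open>C\<close> are the contents of the
    slots before, inside and after the inserted block; \<open>?N\<close>, the filled block, becomes
    the content of the original slot.\<close>
  define A where "A = take (num_slots u) Ls"
  define M where "M = take (num_slots (block x (Suc n))) (drop (num_slots u) Ls)"
  define C where "C = drop (num_slots (block x (Suc n))) (drop (num_slots u) Ls)"
  have len: "length A = num_slots u" "length M = num_slots (block x (Suc n))" "length C = num_slots v"
    using Ls(1) by (simp_all add: A_def M_def C_def large_fills_def uv)
  have eq: "Ls = A @ M @ C" unfolding A_def M_def C_def by (simp only: append_take_drop_id)
  let ?N = "fill_slots (block x (Suc n)) M"
  have "fill_slots (u @ w) (A @ X) = fill_slots u A @ fill_slots w X" for w X
    using fill_slots_take[of u "length A" "A @ X"] by (simp add: fill_slots_append flip: len(1))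
  moreover have "fill_slots (block x (Suc n) @ v) (M @ C) = ?N @ fill_slots v C"
    using fill_slots_take[of "block x (Suc n)" "length M" "M @ C"]
    by (simp add: fill_slots_append flip: len(2))
  ultimately have p: "p = fill_slots c (A @ ?N # C)"
    using Ls(2) by (simp add: uv eq)
  have set_N: "set ?N = insert (Suc n) (\<Union>L\<in>set M. set L)"
    using len(2) by (subst set_fill_slots) auto
  have "a > n" if "L \<in> set Ls" "a \<in> set L" for a L
    using Ls(1) that by (fastforce simp: large_fills_def)
  moreover have "[] \<notin> set Ls" using Ls(1) by (auto simp: large_fills_def)
  moreover have "?N \<noteq> []" using set_N by auto
  ultimately have "large_fills n (num_slots c) (A @ ?N # C)"
    using len set_N unfolding eq large_fills_def by (auto simp: uv)
  then show ?case using p n_def by blast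
qed

section \<open>Slots and vertical alternations\<close>

fun alternating :: "nat \<Rightarrow> bool \<Rightarrow> nat list \<Rightarrow> bool" where
  "alternating n b [] \<longleftrightarrow> True"
| "alternating n b (a # s) \<longleftrightarrow> (n < a \<longleftrightarrow> b) \<and> alternating n (\<not> b) s"

lemma alternating_nth:
  "alternating n b s \<Longrightarrow> i < length s \<Longrightarrow> n < s ! i \<longleftrightarrow> (even i \<longleftrightarrow> b)"
proof (induction s arbitrary: b i)
  case (Cons a s)
  then show ?case by (cases i) auto
qed simp

text \<open>The threshold \<open>n\<close> separates the entries of the two parities, and
  standardization preserves comparisons.\<close>

lemma vertical_alternation_st:
  assumes "alternating n b s" "distinct s"
  shows "vertical_alternation (st s)"
proof -
  have mono: "st s ! i < st s ! j \<longleftrightarrow> s ! i < s ! j" if "i < length s" "j < length s" for i j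
    using that strict_mono_on_less[OF rank_strict_mono[of "set s"]] by (simp add: st_def)
  have "if b then s ! j < s ! i else s ! i < s ! j"
    if "i < length s" "j < length s" "even i" "odd j" for i j
    using alternating_nth[OF assms(1) that(1)] alternating_nth[OF assms(1) that(2)] that by auto
  then show ?thesis
    using mono is_perm_st[OF assms(2)] by (cases b) (auto simp: vertical_alternation_def)
qed

text \<open>Every slot supplies a high entry, and a low old entry stands between consecutive slots;
  picking them in turn yields about two entries per slot. The second conjunct carries the induction:
  after a slot no slot follows directly, so the rest supplies a sequence starting low, to which a
  high entry is prepended.\<close>

lemma fill_slots_alternating:
  assumes "successively (\<lambda>x y. \<not> (x = Slot \<and> y = Slot)) c"
    and "\<forall>a\<in>set (entries c). a \<le> n" and "large_fills n (num_slots c) Ls"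
  shows "(\<exists>s. subseq s (fill_slots c Ls) \<and> alternating n True s \<and> 2 * num_slots c \<le> Suc (length s)) \<and>
    (c = [] \<or> hd c \<noteq> Slot \<longrightarrow>
      (\<exists>s. subseq s (fill_slots c Ls) \<and> alternating n False s \<and> 2 * num_slots c \<le> length s))"
  using assms
proof (induction c Ls rule: fill_slots.induct)
  case (1 Ls)
  then show ?case by (auto intro: exI[of _ "[]"])
next
  case (2 a c Ls)
  then obtain s where s: "subseq s (fill_slots c Ls)" "alternating n True s"
    "2 * num_slots c \<le> Suc (length s)"
    by (auto simp: successively_Cons split: if_splits)
  have "subseq s (fill_slots (Entry a # c) Ls)" using s(1) by auto
  moreover have "subseq (a # s) (fill_slots (Entry a # c) Ls)" using s(1) by simp
  moreover have "alternating n False (a # s)" using s(2) 2 by simp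
  moreover have "2 * num_slots (Entry a # c) \<le> length (a # s)" using s(3) by simp
  ultimately show ?case using s by (metis num_slots_simps(3))
next
  case (3 c Ls)
  then obtain L Ls' where Ls: "Ls = L # Ls'" by (cases Ls) (auto simp: large_fills_def)
  with 3 obtain x L' where L: "L = x # L'" "n < x" by (cases L) (auto simp: large_fills_def)
  have "c = [] \<or> hd c \<noteq> Slot" using 3(2) by (auto simp: successively_Cons)
  moreover have "large_fills n (num_slots c) (tl Ls)" using 3(4) by (auto simp: Ls large_fills_def)
  ultimately obtain s where s: "subseq s (fill_slots c Ls')" "alternating n False s"
    "2 * num_slots c \<le> length s"
    using 3 by (auto simp: Ls successively_Cons)
  have "subseq (x # s) (fill_slots (Slot # c) Ls)"
    using s(1) by (auto simp: Ls L)
  then show ?case using s L by (auto intro!: exI[of _ "x # s"])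
qed

lemma finite_alternations_imp_bounded_slots:
  assumes "finite {p \<in> Av B. vertical_alternation p}"
  shows "\<exists>k. \<forall>c. valid B c \<longrightarrow> num_slots c \<le> k"
proof -
  obtain k where k: "length p \<le> k" if "p \<in> Av B" "vertical_alternation p" for p
    using finite_imageI[OF assms, of length] unfolding finite_nat_set_iff_bounded_le by auto
  have "num_slots c \<le> Suc k" if valid: "valid B c" for c
  proof -
    obtain w p where c: "configuration c" and p: "p \<in> Av B" "apply_word w c = Some (map Entry p)"
      using valid by (auto simp: valid_def completes_def)
    obtain Ls where Ls: "large_fills (length (entries c)) (num_slots c) Ls" "p = fill_slots c Ls"
      using apply_word_fill_slots[OF p(2)] by auto
    obtain s where s: "subseq s p" "alternating (length (entries c)) True s"
      "2 * num_slots c \<le> Suc (length s)"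
      using fill_slots_alternating[OF _ _ Ls(1)] c Ls(2)
      by (auto simp: configuration_def is_perm_def simp del: in_set_entries)
    have "distinct s" using p(1) s(1) by (auto simp: Av_def is_perm_def dest: subseq_distinct)
    then show ?thesis
      using k[OF st_in_Av[OF p(1) s(1)] vertical_alternation_st[OF s(2)]] s(3) by simp
  qed
  then show ?thesis by blast
qed

text \<open>Two entries of \<open>c\<close> with no slot between them would be adjacent low entries
  of the filling, so slots separate consecutive entries. The sharper bound for a leading slot
  carries the induction.\<close>

lemma fill_slots_separated:
  assumes "successively (\<lambda>a b. \<not> (a \<le> n \<and> b \<le> n)) (fill_slots c Ls)"
    and "\<forall>a\<in>set (entries c). a \<le> n"
  shows "length (entries c) \<le> Suc (num_slots c) \<and>
    (c \<noteq> [] \<and> hd c = Slot \<longrightarrow> length (entries c) \<le> num_slots c)"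
  using assms
proof (induction c Ls rule: fill_slots.induct)
  case (2 a c Ls)
  then have IH: "length (entries c) \<le> Suc (num_slots c)"
      "c \<noteq> [] \<and> hd c = Slot \<longrightarrow> length (entries c) \<le> num_slots c"
    by (auto simp: successively_Cons)
  have "c = [] \<or> hd c = Slot"
  proof (cases c)
    case (Cons x d)
    then show ?thesis using 2 by (cases x) auto
  qed simp
  then show ?case using IH by auto
qed (auto simp: successively_append_iff)

lemma bounded_slots_imp_finite_alternations:
  assumes "\<forall>c. valid B c \<longrightarrow> num_slots c \<le> k"
  shows "finite {p \<in> Av B. vertical_alternation p}"
proof -
  have "length p \<le> 2 * k + 3" if p: "p \<in> Av B" "vertical_alternation p" for p
  proof (cases "2 \<le> length p")
    case True
    have perm: "is_perm p" using p(1) by (simp add: Av_def)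
    obtain r :: nat where r: "r < 2"
      "\<And>i j. i < length p \<Longrightarrow> j < length p \<Longrightarrow> i mod 2 = r \<Longrightarrow> j mod 2 \<noteq> r \<Longrightarrow> p ! i < p ! j"
    proof -
      consider "\<forall>i < length p. \<forall>j < length p. even i \<and> odd j \<longrightarrow> p ! i > p ! j"
        | "\<forall>i < length p. \<forall>j < length p. even i \<and> odd j \<longrightarrow> p ! i < p ! j"
        using p(2) by (auto simp: vertical_alternation_def)
      then show thesis
      proof cases
        case 1
        then show thesis
          by (intro that[of 1]) (auto simp: even_iff_mod_2_eq_zero odd_iff_mod_2_eq_one)
      next
        case 2
        then show thesis
          by (intro that[of 0]) (auto simp: even_iff_mod_2_eq_zero odd_iff_mod_2_eq_one)
      qed
    qed
    \<comment> \<open>Length at least 2 makes \<open>low\<close> nonempty for either parity, so the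
      maximum exists. All other entries exceed it, hence the entries that are at most
      \<open>n\<close> are exactly those at positions in \<open>low\<close>.\<close>
    define low where "low = {i. i < length p \<and> i mod 2 = r}"
    define n where "n = Max ((!) p ` low)"
    have "r \<in> low" using r(1) True by (simp add: low_def)
    have fin: "finite low" by (simp add: low_def)
    have le: "p ! i \<le> n" if "i \<in> low" for i using fin that by (simp add: n_def)
    have "n \<in> (!) p ` low" unfolding n_def using fin \<open>r \<in> low\<close> by (intro Max_in) auto
    then obtain m where m: "m \<in> low" "n = p ! m" by blast
    have "n \<le> length p" using m perm by (auto simp: low_def is_perm_def dest: nth_mem)
    have sep: "successively (\<lambda>a b. \<not> (a \<le> n \<and> b \<le> n)) p"
      unfolding successively_conv_nth
    proof (intro allI impI)
      fix i assume i: "Suc i < length p"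
      have "i \<notin> low \<or> Suc i \<notin> low" by (auto simp: low_def) presburger
      moreover have "n < p ! j" if "j < length p" "j \<notin> low" for j
        using m r(2)[of m j] that by (auto simp: low_def)
      ultimately show "\<not> (p ! i \<le> n \<and> p ! Suc i \<le> n)" using i
        by (metis Suc_lessD leD)
    qed
    \<comment> \<open>At least half of the positions, rounded down, are low, and they carry distinct
      values from \<open>{1..n}\<close>.\<close>
    have "length p div 2 \<le> n"
    proof -
      let ?f = "\<lambda>i. p ! (2 * i + r)"
      have *: "2 * i + r < length p" if "i < length p div 2" for i using that r(1) by auto
      have "inj_on ?f {..<length p div 2}"
        using perm * by (auto simp: inj_on_def is_perm_def nth_eq_iff_index_eq)
      moreover have "?f ` {..<length p div 2} \<subseteq> {1..n}"
      proof
        fix y assume "y \<in> ?f ` {..<length p div 2}"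
        then obtain i where i: "i < length p div 2" "y = ?f i" by auto
        have "2 * i + r \<in> low" using *[OF i(1)] r(1) by (simp add: low_def)
        moreover have "y \<in> set p" using *[OF i(1)] i(2) by simp
        ultimately show "y \<in> {1..n}" using le i(2) perm by (auto simp: is_perm_def)
      qed
      ultimately show ?thesis using card_inj_on_le[of ?f "{..<length p div 2}" "{1..n}"] by simp
    qed
    moreover have "n \<le> Suc k"
    proof -
      have "configuration (map Entry p)"
        using perm by (auto simp: configuration_def successively_map)
          (simp add: successively_conv_nth)
      \<comment> \<open>Removing all entries above \<open>n\<close> leaves \<open>d\<close>, which
        is valid because \<open>w\<close> leads back from it to \<open>p\<close>. By
        \<open>sep\<close>, slots separate its \<open>n\<close> entries.\<close>
      then obtain d w where d: "configuration d" "length (entries d) = n"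
        "apply_word w d = Some (map Entry p)"
        using configuration_predecessor[of "map Entry p" n] \<open>n \<le> length p\<close> by auto
      have "valid B d" using d p(1) by (auto simp: valid_def completes_def)
      then have "num_slots d \<le> k" using assms by blast
      moreover obtain Ls where "p = fill_slots d Ls" using apply_word_fill_slots[OF d(3)] by auto
      with sep have "successively (\<lambda>a b. \<not> (a \<le> n \<and> b \<le> n)) (fill_slots d Ls)" by simp
      moreover have "\<forall>a\<in>set (entries d). a \<le> n"
        using d(1,2) by (simp add: configuration_def is_perm_def del: in_set_entries)
      ultimately show ?thesis using fill_slots_separated[of n d Ls] d(2) by simp
    qed
    ultimately show ?thesis by linarith
  qed simp
  then have "{p \<in> Av B. vertical_alternation p} \<subseteq>
      {p. set p \<subseteq> {1..2 * k + 3} \<and> length p \<le> 2 * k + 3}"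
    unfolding Av_def is_perm_def by (smt (verit) atLeastAtMost_iff le_trans mem_Collect_eq subsetI)
  then show ?thesis by (rule finite_subset) (simp add: finite_lists_length_le)
qed

section \<open>Erasing an entry\<close>

text \<open>Standardization after removing the value \<open>a\<close> from a permutation, in a form
  that does not mention the length. The same map therefore serves before and after further
  insertions.\<close>

definition shift :: "nat \<Rightarrow> nat \<Rightarrow> nat" where
  "shift a b = (if a < b then b - 1 else b)"

text \<open>The entry is named by value and not by position, because insertions move positions but
  keep values; this lets erasing commute with insertions.\<close>

definition erase :: "nat \<Rightarrow> symbol list \<Rightarrow> symbol list" where
  "erase a c = map (map_entry (shift a)) (filter (\<lambda>x. x \<noteq> Entry a) c)"

lemma map_entry_eq_Slot_iff [simp]: "map_entry f x = Slot \<longleftrightarrow> x = Slot"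
  by (cases x) auto

lemma num_slots_map_entry [simp]: "num_slots (map (map_entry f) c) = num_slots c"
  by (induction c rule: entries.induct) auto

lemma entries_map_entry [simp]: "entries (map (map_entry f) c) = map f (entries c)"
  by (induction c rule: entries.induct) auto

lemma entries_filter: "entries (filter (\<lambda>x. x \<noteq> Entry a) c) = filter (\<lambda>b. b \<noteq> a) (entries c)"
  by (induction c rule: entries.induct) auto

lemma erase_simps [simp]:
  "erase a [] = []" "erase a (Slot # c) = Slot # erase a c"
  "erase a (Entry b # c) = (if b = a then erase a c else Entry (shift a b) # erase a c)"
  "erase a (c @ d) = erase a c @ erase a d"
  by (auto simp: erase_def)

lemma num_slots_erase [simp]: "num_slots (erase a c) = num_slots c"
  by (induction c rule: entries.induct) auto

lemma entries_erase: "entries (erase a c) = map (shift a) (filter (\<lambda>b. b \<noteq> a) (entries c))"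
  by (simp add: erase_def entries_filter)

lemma erase_map_Entry: "erase a (map Entry p) = map Entry (map (shift a) (filter (\<lambda>b. b \<noteq> a) p))"
  by (induction p) auto

lemma replace_slot_erase:
  "replace_slot i (erase a ys) (erase a c) = map_option (erase a) (replace_slot i ys c)"
  by (induction i ys c rule: replace_slot.induct) (auto simp: option.map_comp comp_def)

text \<open>The maximum inserted after erasing is one smaller than before, which is just what
  \<open>shift a\<close> does to it, since \<open>a\<close> is at most the old length. The length
  assumption says that exactly one entry is erased.\<close>

lemma insert_max_erase:
  assumes "a \<le> length (entries c)" "length (entries c) = Suc (length (entries (erase a c)))"
  shows "insert_max x (erase a c) = map_option (erase a) (insert_max x c)"
proof -
  have "block x (length (entries c)) = erase a (block x (Suc (length (entries c))))"
    using assms(1) by (cases x) (auto simp: shift_def)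
  then show ?thesis by (simp only: insert_max_eq flip: replace_slot_erase assms(2))
qed

lemma apply_word_erase:
  assumes "a \<le> length (entries c)" "length (entries c) = Suc (length (entries (erase a c)))"
  shows "apply_word w (erase a c) = map_option (erase a) (apply_word w c)"
  using assms
proof (induction w arbitrary: c)
  case (Cons x w)
  note ins = insert_max_erase[OF Cons.prems, of x]
  show ?case
  proof (cases "insert_max x c")
    case (Some d)
    then have "insert_max x (erase a c) = Some (erase a d)" using ins by simp
    then have "length (entries (erase a d)) = Suc (length (entries (erase a c)))"
      using length_entries_apply_word[of "[x]" "erase a c" "erase a d"] by simp
    moreover have "length (entries d) = Suc (length (entries c))"
      using length_entries_apply_word[of "[x]" c d] Some by simp
    ultimately have "apply_word w (erase a d) = map_option (erase a) (apply_word w d)"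
      using Cons by simp
    then show ?thesis using Some ins by simp
  qed (use ins in simp)
qed simp

lemma rank_remove:
  assumes "a \<in> {1..n}" "b \<in> {1..n} - {a}"
  shows "rank ({1..n} - {a}) b = shift a b"
proof -
  have "{x \<in> {1..n} - {a}. x \<le> b} = {1..b} - {a}" using assms(2) by auto
  then show ?thesis using assms by (auto simp: rank_def shift_def card_Diff_singleton_if)
qed

lemma st_filter:
  assumes "is_perm p" "a \<in> set p"
  shows "map (shift a) (filter (\<lambda>b. b \<noteq> a) p) = st (filter (\<lambda>b. b \<noteq> a) p)"
proof -
  have p: "set p = {1..length p}" using assms(1) by (simp only: is_perm_def)
  have "set (filter (\<lambda>b. b \<noteq> a) p) = set p - {a}" by auto
  then have E: "set (filter (\<lambda>b. b \<noteq> a) p) = {1..length p} - {a}" unfolding p .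
  have "a \<in> {1..length p}" using assms(2) unfolding p .
  then have "rank (set (filter (\<lambda>b. b \<noteq> a) p)) b = shift a b" if "b \<in> set (filter (\<lambda>b. b \<noteq> a) p)" for b
    using that rank_remove unfolding E by blast
  then show ?thesis by (simp add: st_def)
qed

lemma split_list_nth:
  assumes "i < length c"
  obtains u v where "c = u @ c ! i # v" "length u = i"
  using that[of "take i c" "drop (Suc i) c"] id_take_nth_drop[OF assms] assms by simp

lemma delete_at_eq_filter:
  assumes "distinct (entries c)" "i < length c" "c ! i = Entry a"
  shows "delete_at i c = filter (\<lambda>x. x \<noteq> Entry a) c"
proof -
  obtain u v where c: "c = u @ Entry a # v" and i: "length u = i"
    using split_list_nth[OF assms(2)] assms(3) by metis
  have *: "filter (\<lambda>x. x \<noteq> Entry a) w = w" if "Entry a \<notin> set w" for w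
    using that by (auto simp: filter_id_conv)
  have "Entry a \<notin> set u" "Entry a \<notin> set v" using assms(1) by (auto simp: c)
  then show ?thesis using * by (simp add: c delete_at_def flip: i)
qed

lemma st_config_delete_at:
  assumes "is_perm (entries c)" "i < length c" "c ! i = Entry a"
  shows "st_config (delete_at i c) = erase a c"
proof -
  let ?d = "filter (\<lambda>x. x \<noteq> Entry a) c"
  have "Entry a \<in> set c" using assms(2,3) by (metis nth_mem)
  then have a: "a \<in> set (entries c)" by simp
  have E: "set (entries c) = {1..length (entries c)}" using assms(1) by (simp only: is_perm_def)
  have "set (entries ?d) = set (entries c) - {a}" by (auto simp: entries_filter simp del: in_set_entries)
  then have "set (entries ?d) = {1..length (entries c)} - {a}" unfolding E .
  moreover have "map_entry (rank ({1..length (entries c)} - {a})) x = map_entry (shift a) x"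
    if "x \<in> set ?d" for x
  proof (cases x)
    case (Entry b)
    then have "b \<in> set (entries c)" "b \<noteq> a" using that by auto
    then have "rank ({1..length (entries c)} - {a}) b = shift a b"
      using rank_remove a unfolding E by blast
    then show ?thesis using Entry by simp
  qed simp
  ultimately show ?thesis
    using delete_at_eq_filter[of c i a] assms by (simp add: is_perm_def st_config_def erase_def)
qed

text \<open>Deletion could only fail by bringing two slots together, which
  \<open>between_slots\<close> describes.\<close>

lemma configuration_erase:
  assumes "configuration c" "i < length c" "c ! i = Entry a" "\<not> between_slots c i"
  shows "configuration (erase a c)"
proof -
  let ?P = "\<lambda>x y. \<not> (x = Slot \<and> y = Slot)"
  obtain u v where uv: "c = u @ Entry a # v" "length u = i"
    using split_list_nth[OF assms(2)] assms(3) by metis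
  have perm: "is_perm (entries c)" using assms(1) by (simp add: configuration_def)
  have "Entry a \<in> set c" using assms(2,3) by (metis nth_mem)
  then have "is_perm (entries (erase a c))"
    using perm is_perm_st[of "filter (\<lambda>b. b \<noteq> a) (entries c)"]
    by (simp add: entries_erase st_filter distinct_filter[OF conjunct1[OF perm[unfolded is_perm_def]]])
  moreover have "successively ?P (delete_at i c)"
  proof -
    have "successively ?P u" "successively ?P v"
      using assms(1) unfolding uv(1) configuration_def
      by (auto simp: successively_append_iff successively_Cons)
    moreover have "u = [] \<or> v = [] \<or> ?P (last u) (hd v)"
      using assms(4) unfolding uv(1) uv(2)[symmetric]
      by (auto simp: between_slots_def last_conv_nth hd_conv_nth nth_append)
    ultimately show ?thesis
      unfolding uv(1) uv(2)[symmetric] by (simp add: delete_at_def successively_append_iff)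
  qed
  then have "successively ?P (erase a c)"
    using delete_at_eq_filter[OF _ assms(2,3)] perm
    by (simp add: erase_def successively_map is_perm_def)
  ultimately show ?thesis by (simp add: configuration_def)
qed

text \<open>Since erasing commutes with insertions, completing \<open>erase a c\<close> amounts to
  completing \<open>c\<close> by the same word and then deleting \<open>a\<close> from the
  result.\<close>

lemma completes_erase_iff:
  assumes "configuration c" "Entry a \<in> set c"
  shows "completes B w (erase a c) \<longleftrightarrow>
    (\<exists>p. apply_word w c = Some (map Entry p) \<and> st (filter (\<lambda>b. b \<noteq> a) p) \<in> Av B)"
proof -
  have perm: "is_perm (entries c)" using assms(1) by (simp add: configuration_def)
  have a: "a \<in> set (entries c)" using assms(2) by simp
  have "a \<in> {1..length (entries c)}" using perm a by (simp only: is_perm_def)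
  then have "a \<le> length (entries c)" by simp
  moreover have "length (entries c) = Suc (length (entries (erase a c)))"
  proof -
    have "length (filter (\<lambda>b. b \<noteq> a) (entries c)) = length (entries c) - 1"
    proof -
      have "filter (\<lambda>b. b \<noteq> a) (entries c) = remove1 a (entries c)"
        using perm by (simp add: is_perm_def distinct_remove1_removeAll removeAll_filter_not_eq neq_commute)
      then show ?thesis using a by (simp add: length_remove1)
    qed
    moreover have "entries c \<noteq> []" using a by (metis empty_iff list.set(1))
    ultimately show ?thesis by (simp add: entries_erase)
  qed
  ultimately have aw: "apply_word w (erase a c) = map_option (erase a) (apply_word w c)"
    by (rule apply_word_erase)
  have st: "map (shift a) (filter (\<lambda>b. b \<noteq> a) p) = st (filter (\<lambda>b. b \<noteq> a) p)"
    if p: "apply_word w c = Some (map Entry p)" for p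
  proof (rule st_filter)
    show "is_perm p" using configuration_apply_word[OF p assms(1)] by (simp add: configuration_def)
    obtain Ls where "large_fills (length (entries c)) (num_slots c) Ls" "p = fill_slots c Ls"
      using apply_word_fill_slots[OF p] by blast
    then show "a \<in> set p" using a set_fill_slots[of Ls c] by (auto simp: large_fills_def)
  qed
  show ?thesis
  proof
    assume "completes B w (erase a c)"
    then obtain p' e where p': "p' \<in> Av B" "apply_word w c = Some e" "erase a e = map Entry p'"
      by (auto simp: completes_def aw)
    \<comment> \<open>Erasing keeps all slots, so \<open>e\<close> is slotless because its erasure
      is.\<close>
    have "num_slots e = 0" using arg_cong[OF p'(3), of num_slots] by simp
    then obtain p where "e = map Entry p"
      using slotless_eq_map_Entry[of e] by (auto simp: num_slots_def count_list_0_iff)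
    with p' have "apply_word w c = Some (map Entry p)"
      and "p' = map (shift a) (filter (\<lambda>b. b \<noteq> a) p)"
      by (simp_all add: erase_map_Entry inj_map_eq_map inj_def del: map_map)
    then show "\<exists>p. apply_word w c = Some (map Entry p) \<and> st (filter (\<lambda>b. b \<noteq> a) p) \<in> Av B"
      using st p'(1) by auto
  next
    assume "\<exists>p. apply_word w c = Some (map Entry p) \<and> st (filter (\<lambda>b. b \<noteq> a) p) \<in> Av B"
    then obtain p where p: "apply_word w c = Some (map Entry p)" "st (filter (\<lambda>b. b \<noteq> a) p) \<in> Av B"
      by blast
    then show "completes B w (erase a c)"
      using st[OF p(1)] by (auto simp: completes_def aw erase_map_Entry simp del: map_map)
  qed
qed

section \<open>Patterns around the slots\<close>

lemma fill_slots_map_entry: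
  "length Ls = num_slots c \<Longrightarrow>
     fill_slots (map (map_entry f) c) (map (map f) Ls) = map f (fill_slots c Ls)"
proof (induction c Ls rule: fill_slots.induct)
  case (3 c Ls)
  then show ?case by (cases Ls) auto
qed auto

lemma fill_slots_filter:
  "length Ls = num_slots c \<Longrightarrow> \<forall>L\<in>set Ls. a \<notin> set L \<Longrightarrow>
     fill_slots (filter (\<lambda>x. x \<noteq> Entry a) c) Ls = filter (\<lambda>b. b \<noteq> a) (fill_slots c Ls)"
proof (induction c Ls rule: fill_slots.induct)
  case (3 c Ls)
  then obtain L Ls' where "Ls = L # Ls'" by (cases Ls) auto
  moreover from this 3 have "filter (\<lambda>b. b \<noteq> a) L = L" by (auto simp: filter_id_conv)
  ultimately show ?case using 3 by simp
qed auto

text \<open>A subsequence of a filling fills a subsequence of the configuration that retains all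
  slots. Thus only the part of an occurrence of a pattern among the old entries, cut up by the
  slots, matters for the effect of future insertions.\<close>

lemma subseq_fill_slots_iff:
  "length Ls = num_slots c \<Longrightarrow> subseq s (fill_slots c Ls) \<longleftrightarrow>
     (\<exists>q Ts. subseq q c \<and> num_slots q = num_slots c \<and> list_all2 subseq Ts Ls \<and> s = fill_slots q Ts)"
  (is "_ \<Longrightarrow> _ \<longleftrightarrow> ?R c Ls s")
proof
  show "?R c Ls s" if "length Ls = num_slots c" "subseq s (fill_slots c Ls)"
    using that
  proof (induction c Ls arbitrary: s rule: fill_slots.induct)
    case (1 Ls)
    then show ?case by (intro exI[of _ "[]"]) auto
  next
    case (2 a c Ls)
    show ?case
    proof (cases "subseq s (fill_slots c Ls)")
      case True
      then obtain q Ts where "subseq q c" "num_slots q = num_slots c" "list_all2 subseq Ts Ls"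
        "s = fill_slots q Ts"
        using 2(1)[OF _ True] 2(2) by auto
      then show ?thesis by (intro exI[of _ q] exI[of _ Ts]) auto
    next
      case False
      then obtain s' where s': "s = a # s'" "subseq s' (fill_slots c Ls)"
        using 2(3) by (cases s) (auto split: if_splits)
      then obtain q Ts where "subseq q c" "num_slots q = num_slots c" "list_all2 subseq Ts Ls"
        "s' = fill_slots q Ts"
        using 2(1)[of s'] 2(2) by auto
      then show ?thesis by (intro exI[of _ "Entry a # q"] exI[of _ Ts]) (auto simp: s')
    qed
  next
    case (3 c Ls)
    obtain L Ls' where Ls: "Ls = L # Ls'" using 3(2) by (cases Ls) auto
    obtain t s' where s: "s = t @ s'" "subseq t L" "subseq s' (fill_slots c Ls')"
      using 3(3) by (auto simp: Ls elim: subseq_appendE)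
    then obtain q Ts where "subseq q c" "num_slots q = num_slots c" "list_all2 subseq Ts Ls'"
        "s' = fill_slots q Ts"
      using 3(1)[of s'] 3(2) by (auto simp: Ls)
    then show ?case using s by (intro exI[of _ "Slot # q"] exI[of _ "t # Ts"]) (auto simp: Ls)
  qed
next
  assume len: "length Ls = num_slots c" and "?R c Ls s"
  then obtain q Ts where "subseq q c" "num_slots q = num_slots c" "list_all2 subseq Ts Ls"
    and s: "s = fill_slots q Ts"
    by blast
  then show "subseq s (fill_slots c Ls)"
    unfolding s using len
  proof (induction q c arbitrary: Ts Ls rule: list_emb.induct)
    case (list_emb_Nil c)
    then show ?case by simp
  next
    case (list_emb_Cons q c y)
    \<comment> \<open>A skipped symbol must be an entry: after skipping a slot, \<open>q\<close>
      could not retain all slots.\<close>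
    have "num_slots q \<le> num_slots c"
      using list_emb_Cons.hyps by (induction rule: list_emb.induct) (auto simp: num_slots_def)
    then obtain a where y: "y = Entry a" using list_emb_Cons.prems by (cases y) auto
    then show ?case using list_emb_Cons by auto
  next
    case (list_emb_Cons2 x y q c)
    show ?case
    proof (cases x)
      case Slot
      then obtain T Ts' L Ls' where "Ts = T # Ts'" "Ls = L # Ls'"
        using list_emb_Cons2 by (cases Ts; cases Ls) auto
      then show ?thesis
        using list_emb_Cons2 Slot by (auto intro: list_emb_append_mono)
    qed (use list_emb_Cons2 in auto)
  qed
qed

text \<open>Old entries are at most \<open>n\<close> and new ones above it. The map \<open>g\<close>
  ranks the old entries and fixes the new ones; ranks stay at most \<open>n\<close>, so
  \<open>g\<close> preserves all comparisons.\<close>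

lemma st_fill_slots_st_config:
  assumes "\<forall>a\<in>set (entries q). a \<in> {1..n}" "length Ts = num_slots q"
    and "\<forall>T\<in>set Ts. \<forall>a\<in>set T. n < a"
  shows "st (fill_slots (st_config q) Ts) = st (fill_slots q Ts)"
proof -
  let ?E = "set (entries q)"
  define g where "g a = (if a \<le> n then rank ?E a else a)" for a
  have "map g T = T" if "T \<in> set Ts" for T
    using assms(3) that by (intro map_idI) (fastforce simp: g_def)
  then have "map (map g) Ts = Ts" by (rule map_idI)
  moreover have "map (map_entry g) q = st_config q"
    unfolding st_config_def
  proof (rule map_cong[OF refl])
    fix x assume "x \<in> set q"
    then have "a \<le> n" if "x = Entry a" for a using assms(1) that by auto
    then show "map_entry g x = map_entry (rank ?E) x" by (cases x) (simp_all add: g_def)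
  qed
  ultimately have "fill_slots (st_config q) Ts = map g (fill_slots q Ts)"
    using fill_slots_map_entry[OF assms(2), of g] by simp
  moreover have "strict_mono_on (set (fill_slots q Ts)) g"
  proof (rule strict_mono_onI)
    fix a b assume ab: "a \<in> set (fill_slots q Ts)" "b \<in> set (fill_slots q Ts)" "a < b"
    have set: "set (fill_slots q Ts) = ?E \<union> (\<Union>T\<in>set Ts. set T)"
      using assms(2) by (rule set_fill_slots)
    have E: "x \<in> ?E" if "x \<in> set (fill_slots q Ts)" "x \<le> n" for x
      using that assms(3) unfolding set by force
    have "card ?E \<le> card {1..n}" using assms(1) by (intro card_mono) auto
    then have "rank ?E x \<le> n" if "x \<in> ?E" for x
      using rank_bounds[of ?E x] that by auto
    then show "g a < g b"
      using E ab strict_mono_onD[OF rank_strict_mono, of ?E a b]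
      by (fastforce simp: g_def simp del: in_set_entries)
  qed
  ultimately show ?thesis using st_map by metis
qed

text \<open>Keeping every slot records where the chosen entries lie relative to all future material.
  Slots may become adjacent, so a pattern is not always a configuration.\<close>

definition slot_pattern :: "symbol list \<Rightarrow> symbol list \<Rightarrow> bool" where
  "slot_pattern q c \<longleftrightarrow> subseq q c \<and> num_slots q = num_slots c"

lemma st_config_bounds:
  assumes "length (entries q) \<le> m"
  shows "set (st_config q) \<subseteq> insert Slot (Entry ` {1..m})"
proof
  fix x assume "x \<in> set (st_config q)"
  then obtain y where y: "y \<in> set q" "x = map_entry (rank (set (entries q))) y"
    by (auto simp: st_config_def)
  have "card (set (entries q)) \<le> m" using card_length[of "entries q"] assms by linarith
  then show "x \<in> insert Slot (Entry ` {1..m})"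
    using y rank_bounds[of "set (entries q)"] by (cases y) fastforce+
qed

text \<open>An occurrence of a basis element that uses \<open>a\<close> can be rerouted: its old
  part is exchanged for one with the same standardization that avoids \<open>a\<close>, while its
  new part stays. Old parts have at most \<open>m\<close> entries because basis elements do.\<close>

lemma indistinguishable_erase:
  assumes c: "configuration c" and a: "Entry a \<in> set c" and m: "\<forall>\<beta>\<in>B. length \<beta> \<le> m"
    and witness: "\<And>q. slot_pattern q c \<Longrightarrow> length (entries q) \<le> m \<Longrightarrow>
      \<exists>q'. slot_pattern q' c \<and> st_config q' = st_config q \<and> Entry a \<notin> set q'"
  shows "indistinguishable B c (erase a c)"
proof -
  have "completes B w c \<longleftrightarrow> completes B w (erase a c)" for w
  proof -
    have "p \<in> Av B \<longleftrightarrow> st (filter (\<lambda>b. b \<noteq> a) p) \<in> Av B"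
      if p: "apply_word w c = Some (map Entry p)" for p
    proof
      show "st (filter (\<lambda>b. b \<noteq> a) p) \<in> Av B" if "p \<in> Av B" using that by (rule st_in_Av) simp
    next
      assume *: "st (filter (\<lambda>b. b \<noteq> a) p) \<in> Av B"
      let ?n = "length (entries c)"
      have perm: "is_perm p"
        using configuration_apply_word[OF p c] by (simp add: configuration_def)
      obtain Ls where Ls: "large_fills ?n (num_slots c) Ls" "p = fill_slots c Ls"
        using apply_word_fill_slots[OF p] by blast
      have len: "length Ls = num_slots c" using Ls(1) by (simp add: large_fills_def)
      have E: "set (entries c) = {1..?n}" using c by (simp only: configuration_def is_perm_def)
      have "contains (filter (\<lambda>b. b \<noteq> a) p) \<beta>" if \<beta>: "\<beta> \<in> B" "contains p \<beta>" for \<beta>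
      proof -
        \<comment> \<open>The occurrence splits into a pattern \<open>q\<close> of old entries and
          the parts \<open>Ts\<close> taken from the slot contents.\<close>
        obtain s where s: "subseq s p" "st s = \<beta>" using \<beta>(2) by (auto simp: contains_def)
        then obtain q Ts where q: "slot_pattern q c" "list_all2 subseq Ts Ls" "s = fill_slots q Ts"
          using subseq_fill_slots_iff[OF len] Ls(2) by (auto simp: slot_pattern_def)
        have len_Ts: "length Ts = num_slots c" using list_all2_lengthD[OF q(2)] len by simp
        have "length (entries q) \<le> length (fill_slots q Ts')" for Ts'
          by (induction q Ts' rule: fill_slots.induct) auto
        then have "length (entries q) \<le> length s" using q(3) by simp
        also have "length s \<le> m" using m s(2) \<beta>(1) by auto
        finally obtain q' where q': "slot_pattern q' c" "st_config q' = st_config q" "Entry a \<notin> set q'"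
          using witness[OF q(1)] by blast
        have large: "\<forall>T\<in>set Ts. \<forall>b\<in>set T. ?n < b"
        proof (intro ballI)
          fix T b assume "T \<in> set Ts" "b \<in> set T"
          then obtain L where "L \<in> set Ls" "subseq T L"
            using q(2) by (metis in_set_conv_nth list_all2_conv_all_nth)
          then show "?n < b" using Ls(1) \<open>b \<in> set T\<close> subseq_set by (fastforce simp: large_fills_def)
        qed
        have range: "\<forall>b\<in>set (entries r). b \<in> {1..?n}" if "slot_pattern r c" for r
        proof
          fix b assume "b \<in> set (entries r)"
          then have "Entry b \<in> set c" using that subseq_set by (auto simp: slot_pattern_def)
          then have "b \<in> set (entries c)" by simp
          then show "b \<in> {1..?n}" using E by blast
        qed
        have st: "st (fill_slots q' Ts) = \<beta>"
          using st_fill_slots_st_config[OF range[OF q(1)] _ large]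
            st_fill_slots_st_config[OF range[OF q'(1)] _ large] q q' len_Ts s(2)
          by (simp add: slot_pattern_def)
        have "filter (\<lambda>x. x \<noteq> Entry a) q' = q'" using q'(3) by (auto simp: filter_id_conv)
        then have "subseq q' (filter (\<lambda>x. x \<noteq> Entry a) c)"
          using q'(1) subseq_filter[of q' c "\<lambda>x. x \<noteq> Entry a"] by (simp add: slot_pattern_def)
        moreover have filter_slots: "num_slots (filter (\<lambda>x. x \<noteq> Entry a) c) = num_slots c"
          using num_slots_erase[of a c] by (simp add: erase_def)
        ultimately have "subseq (fill_slots q' Ts) (fill_slots (filter (\<lambda>x. x \<noteq> Entry a) c) Ls)"
          using subseq_fill_slots_iff[of Ls "filter (\<lambda>x. x \<noteq> Entry a) c"] len q'(1) q(2)
          by (auto simp: slot_pattern_def)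
        moreover have "a \<in> set (entries c)" using a by simp
        then have "a \<le> ?n" using E by auto
        then have "\<forall>L\<in>set Ls. a \<notin> set L" using Ls(1) by (fastforce simp: large_fills_def)
        ultimately show ?thesis
          using st fill_slots_filter[OF len] Ls(2) by (auto simp: contains_def)
      qed
      moreover have "distinct (filter (\<lambda>b. b \<noteq> a) p)" using perm by (simp add: is_perm_def)
      ultimately show "p \<in> Av B"
        using * perm st_in_Av_iff[of "filter (\<lambda>b. b \<noteq> a) p" B] by (auto simp: Av_def)
    qed
    then show ?thesis
      unfolding completes_erase_iff[OF c a] by (auto simp: completes_def)
  qed
  then show ?thesis by (simp add: indistinguishable_def distinguishes_def)
qed

section \<open>Reducible entries in long configurations\<close>

lemma entry_position_unique:
  assumes "distinct (entries c)" "i < length c" "j < length c" "c ! i = Entry a" "c ! j = Entry a"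
  shows "i = j"
proof -
  have False if ij: "i < j" "j < length c" "c ! i = Entry a" "c ! j = Entry a" for i j
  proof -
    obtain u v where c: "c = u @ Entry a # v" "length u = i"
      using split_list_nth[of i c] ij by (metis order.strict_trans)
    then have "Entry a \<notin> set v" using assms(1) by auto
    moreover have "c ! j = v ! (j - Suc i)" "j - Suc i < length v"
      using ij(1,2) unfolding c(1) c(2)[symmetric] by (auto simp: nth_append nth_Cons')
    ultimately show False using ij(4) by (metis nth_mem)
  qed
  then show ?thesis using assms by (metis linorder_neqE_nat)
qed

lemma bounded_slots_imp_reducible:
  assumes "finite B" and k: "\<forall>c. valid B c \<longrightarrow> num_slots c \<le> k"
  shows "\<exists>N. \<forall>c. valid B c \<and> length c \<ge> N \<longrightarrow> (\<exists>i. IE_reducible B c i)"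
proof -
  obtain m where m: "\<forall>\<beta>\<in>B. length \<beta> \<le> m"
    using finite_imageI[OF assms(1), of length] unfolding finite_nat_set_iff_bounded_le by auto
  \<comment> \<open>A finite set, independent of \<open>c\<close>, that contains every standardized
    pattern with at most \<open>m\<close> entries and \<open>k\<close> slots. Below,
    \<open>R\<close> collects those that occur in \<open>c\<close>, and \<open>Q\<close> picks one
    witness for each.\<close>
  define P where "P = {\<pi>. set \<pi> \<subseteq> insert Slot (Entry ` {1..m}) \<and> length \<pi> \<le> m + k}"
  have "finite P" unfolding P_def by (rule finite_lists_length_le) simp
  have "\<exists>i. IE_reducible B c i"
    if valid: "valid B c" and long: "length c > 2 * k + card P * (m + k)" for c
  proof -
    have c: "configuration c" using valid by (simp add: valid_def)
    have dist: "distinct (entries c)" using c by (simp add: configuration_def is_perm_def)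
    define R where "R = {\<pi> \<in> P. \<exists>q. slot_pattern q c \<and> st_config q = \<pi>}"
    have "\<forall>\<pi>\<in>R. \<exists>q. slot_pattern q c \<and> st_config q = \<pi>" by (auto simp: R_def)
    then obtain Q where Q: "\<forall>\<pi>\<in>R. slot_pattern (Q \<pi>) c \<and> st_config (Q \<pi>) = \<pi>" by metis
    have R: "finite R" "card R \<le> card P"
      using \<open>finite P\<close> by (auto simp: R_def intro: card_mono)
    \<comment> \<open>The positions to be avoided: slots, entries between two slots, and entries of
      the chosen witnesses. Their number is bounded independently of \<open>c\<close>, and any other
      position is IE-reducible.\<close>
    define S where "S = {i. i < length c \<and> c ! i = Slot}"
    define T where "T = {i. i < length c \<and> between_slots c i}"
    define U where "U = {i. i < length c \<and> c ! i \<noteq> Slot \<and> c ! i \<in> (\<Union>\<pi>\<in>R. set (Q \<pi>))}"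
    have fin: "finite S" "finite T" "finite U" by (simp_all add: S_def T_def U_def)
    have "card S = num_slots c"
      unfolding S_def num_slots_def count_list_eq_length_filter length_filter_conv_card
      by (rule arg_cong[of _ _ card]) auto
    then have S: "card S \<le> k" using k valid by simp
    \<comment> \<open>An entry between two slots is determined by the slot to its right.\<close>
    have "card T \<le> card S"
    proof (rule card_inj_on_le[of Suc])
      show "Suc ` T \<subseteq> S" by (auto simp: S_def T_def between_slots_def)
    qed (simp_all add: fin)
    moreover have "card U \<le> card P * (m + k)"
    proof -
      have "inj_on ((!) c) U"
      proof (rule inj_onI)
        fix i j assume ij: "i \<in> U" "j \<in> U" "c ! i = c ! j"
        then have "c ! i \<noteq> Slot" by (simp add: U_def)
        with ij obtain b where "c ! i = Entry b" by (metis symbol.exhaust)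
        with ij have "i < length c" "j < length c" "c ! i = Entry b" "c ! j = Entry b"
          by (simp_all add: U_def)
        then show "i = j" by (rule entry_position_unique[OF dist])
      qed
      then have "card U \<le> card (\<Union>\<pi>\<in>R. set (Q \<pi>))"
        by (rule card_inj_on_le) (auto simp: U_def R)
      also have "\<dots> \<le> (\<Sum>\<pi>\<in>R. card (set (Q \<pi>)))" by (rule card_UN_le[OF R(1)])
      also have "\<dots> \<le> card R * (m + k)"
      proof (rule sum_bounded_above[of R _ "m + k", simplified])
        fix \<pi> assume \<pi>: "\<pi> \<in> R"
        then have "length (Q \<pi>) = length \<pi>" using Q by (metis st_config_def length_map)
        moreover have "length \<pi> \<le> m + k" using \<pi> by (simp add: R_def P_def)
        ultimately show "card (set (Q \<pi>)) \<le> m + k" using card_length[of "Q \<pi>"] by linarith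
      qed
      also have "\<dots> \<le> card P * (m + k)" using R(2) by simp
      finally show ?thesis .
    qed
    ultimately have "card (S \<union> T \<union> U) \<le> 2 * k + card P * (m + k)"
      using S card_Un_le[of "S \<union> T" U] card_Un_le[of S T] by linarith
    then have "\<not> {..<length c} \<subseteq> S \<union> T \<union> U"
      using long card_mono[of "S \<union> T \<union> U" "{..<length c}"] fin by auto
    then obtain i where i: "i < length c" "i \<notin> S" "i \<notin> T" "i \<notin> U" by auto
    then obtain a where a: "c ! i = Entry a" by (cases "c ! i") (auto simp: S_def)
    have "indistinguishable B c (erase a c)"
    proof (rule indistinguishable_erase[OF c _ m])
      show "Entry a \<in> set c" using i(1) a by (metis nth_mem)
    next
      fix q assume q: "slot_pattern q c" "length (entries q) \<le> m"
      have "num_slots q \<le> k" using q(1) k valid by (simp add: slot_pattern_def)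
      then have "length (st_config q) \<le> m + k"
        using q(2) length_eq_entries_slots[of q] by (simp add: st_config_def)
      then have "st_config q \<in> R"
        using q st_config_bounds[OF q(2)] by (auto simp: R_def P_def)
      moreover from this have "Entry a \<notin> set (Q (st_config q))" using i a by (auto simp: U_def)
      ultimately show "\<exists>q'. slot_pattern q' c \<and> st_config q' = st_config q \<and> Entry a \<notin> set q'"
        using Q by blast
    qed
    moreover have "st_config (delete_at i c) = erase a c"
      using c i(1) a by (intro st_config_delete_at) (auto simp: configuration_def)
    ultimately have "IE_reducible B c i"
      using valid i a by (simp add: IE_reducible_def T_def)
    then show ?thesis ..
  qed
  then show ?thesis by (intro exI[of _ "Suc (2 * k + card P * (m + k))"]) auto
qed

text \<open>Reducible entries are deleted one after another. Each deletion shortens the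
  configuration but keeps its slots and its completing words, hence its validity, so the assumption
  applies again until the length is below \<open>N\<close>.\<close>

lemma short_representative:
  assumes N: "\<forall>c. valid B c \<and> length c \<ge> N \<longrightarrow> (\<exists>i. IE_reducible B c i)"
    and "valid B c"
  obtains d where "valid B d" "length d < N" "num_slots d = num_slots c" "indistinguishable B c d"
proof -
  have "\<exists>d. valid B d \<and> length d < N \<and> num_slots d = num_slots c \<and> indistinguishable B c d"
    using assms(2)
  proof (induction "length c" arbitrary: c rule: less_induct)
    case less
    show ?case
    proof (cases "length c < N")
      case True
      then show ?thesis
        using less.prems by (intro exI[of _ c]) (auto simp: indistinguishable_def distinguishes_def)
    next
      case False
      then obtain i where i: "IE_reducible B c i" using N less.prems by auto
      then obtain a where a: "c ! i = Entry a" by (cases "c ! i") (auto simp: IE_reducible_def)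
      have c: "configuration c" using less.prems by (simp add: valid_def)
      have eq: "st_config (delete_at i c) = erase a c"
        using c i a by (intro st_config_delete_at) (auto simp: configuration_def IE_reducible_def)
      then have ind: "indistinguishable B c (erase a c)" using i by (simp add: IE_reducible_def)
      moreover have "configuration (erase a c)"
        using configuration_erase[OF c _ a] i by (simp add: IE_reducible_def)
      ultimately have "valid B (erase a c)"
        using less.prems by (auto simp: valid_def indistinguishable_def distinguishes_def)
      moreover have "length (erase a c) < length c"
        using i unfolding eq[symmetric] by (auto simp: st_config_def delete_at_def IE_reducible_def)
      ultimately obtain d where "valid B d" "length d < N" "num_slots d = num_slots c"
        "indistinguishable B (erase a c) d"
        using less.hyps[of "erase a c"] by auto
      then show ?thesis
        using ind by (intro exI[of _ d]) (auto simp: indistinguishable_def distinguishes_def)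
    qed
  qed
  with that show thesis by blast
qed

lemma reducible_imp_bounded_slots:
  assumes "\<forall>c. valid B c \<and> length c \<ge> N \<longrightarrow> (\<exists>i. IE_reducible B c i)" "valid B c"
  shows "num_slots c \<le> N"
proof -
  obtain d where "length d < N" "num_slots d = num_slots c"
    using short_representative[OF assms] by blast
  then show ?thesis using length_eq_entries_slots[of d] by linarith
qed

section \<open>Regularity\<close>

text \<open>The Myhill-Nerode automaton: its states are the left quotients of \<open>L\<close>,
  coded as natural numbers by \<open>e\<close>, and a state accepts if its quotient contains the
  empty word.\<close>

lemma regular_if_finite_quotients:
  fixes L :: "'a list set"
  assumes "finite \<Sigma>" "L \<subseteq> lists \<Sigma>" and fin: "finite (range (\<lambda>u. {v. u @ v \<in> L}))"
  shows "regular L"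
proof -
  let ?R = "\<lambda>u. {v. u @ v \<in> L}"
  obtain e :: "'a list set \<Rightarrow> nat" where e: "inj_on e (range ?R)"
    using finite_imp_inj_to_nat_seg[OF fin] by auto
  \<comment> \<open>A state is decoded, its quotient is taken by the letter, and the result is coded
    again.\<close>
  define \<delta> where "\<delta> q a = e {v. a # v \<in> the_inv_into (range ?R) e q}" for q a
  have inv: "the_inv_into (range ?R) e (e (?R u)) = ?R u" for u
    using e by (rule the_inv_into_f_f) simp
  have step: "\<delta> (e (?R u)) a = e (?R (u @ [a]))" for u a by (simp add: \<delta>_def inv)
  have run: "foldl \<delta> (e (?R u)) w = e (?R (u @ w))" for u w
  proof (induction w arbitrary: u)
    case (Cons a w)
    show ?case using Cons.IH[of "u @ [a]"] step[of u a] by simp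
  qed simp
  have "foldl \<delta> (e (?R [])) w \<in> e ` {X \<in> range ?R. [] \<in> X} \<longleftrightarrow> w \<in> L" for w
  proof -
    have "e (?R w) \<in> e ` {X \<in> range ?R. [] \<in> X} \<longleftrightarrow> ?R w \<in> {X \<in> range ?R. [] \<in> X}"
      by (rule inj_on_image_mem_iff[OF e]) auto
    then show ?thesis using run[of "[]" w] by simp
  qed
  then have "L = {w \<in> lists \<Sigma>. foldl \<delta> (e (?R [])) w \<in> e ` {X \<in> range ?R. [] \<in> X}}"
    using assms(2) by auto
  moreover have "\<forall>q\<in>e ` range ?R. \<forall>a\<in>\<Sigma>. \<delta> q a \<in> e ` range ?R"
  proof (intro ballI)
    fix q a assume "q \<in> e ` range ?R"
    then obtain u where "q = e (?R u)" by blast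
    then show "\<delta> q a \<in> e ` range ?R" using step[of u a] by blast
  qed
  moreover have "finite (e ` range ?R)" using fin by simp
  moreover have "e (?R []) \<in> e ` range ?R" by blast
  moreover have "e ` {X \<in> range ?R. [] \<in> X} \<subseteq> e ` range ?R" by blast
  ultimately show ?thesis
    unfolding regular_def using assms(1)
    by (intro exI[of _ \<Sigma>] exI[of _ "e ` range ?R"] exI[of _ \<delta>] exI[of _ "e (?R [])"]
        exI[of _ "e ` {X \<in> range ?R. [] \<in> X}"] conjI)
qed

text \<open>Which words complete a prefix depends only on the state reached, so one completing word
  for each of the finitely many states suffices.\<close>

lemma regular_imp_bounded_completion:
  assumes "regular L"
  shows "\<exists>k. \<forall>u v. u @ v \<in> L \<longrightarrow> (\<exists>v'. u @ v' \<in> L \<and> length v' \<le> k)"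
proof -
  obtain \<Sigma> Q \<delta> q0 F where A: "finite (Q :: nat set)" "q0 \<in> Q" "\<forall>q\<in>Q. \<forall>a\<in>\<Sigma>. \<delta> q a \<in> Q"
    and L: "L = {w \<in> lists \<Sigma>. foldl \<delta> q0 w \<in> F}"
    using assms unfolding regular_def by blast
  have run: "foldl \<delta> q u \<in> Q" if "q \<in> Q" "u \<in> lists \<Sigma>" for q u
    using that A(3) by (induction u arbitrary: q) auto
  \<comment> \<open>At a state without a completing word the value is arbitrary. It enters the bound
    \<open>k\<close>, but \<open>V\<close> is applied only where such a word exists.\<close>
  define V where "V q = (SOME v. v \<in> lists \<Sigma> \<and> foldl \<delta> q v \<in> F)" for q
  obtain k where k: "\<forall>q\<in>Q. length (V q) \<le> k"
    using finite_imageI[OF A(1), of "length \<circ> V"] unfolding finite_nat_set_iff_bounded_le by auto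
  have "\<exists>v'. u @ v' \<in> L \<and> length v' \<le> k" if "u @ v \<in> L" for u v
  proof -
    let ?q = "foldl \<delta> q0 u"
    have uv: "u \<in> lists \<Sigma>" "v \<in> lists \<Sigma>" "foldl \<delta> ?q v \<in> F" using that by (auto simp: L)
    then have "\<exists>v. v \<in> lists \<Sigma> \<and> foldl \<delta> ?q v \<in> F" by blast
    then have "V ?q \<in> lists \<Sigma> \<and> foldl \<delta> ?q (V ?q) \<in> F" unfolding V_def by (rule someI_ex)
    then have "u @ V ?q \<in> L" using uv(1) by (auto simp: L)
    moreover have "length (V ?q) \<le> k" using k run[OF A(2) uv(1)] by blast
    ultimately show ?thesis by blast
  qed
  then show ?thesis by blast
qed

text \<open>The empty permutation is excluded automatically: \<open>[Slot]\<close> is not slotless,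
  so a completing word is nonempty and inserts an entry.\<close>

lemma in_insertion_encodings_iff: "w \<in> insertion_encodings B \<longleftrightarrow> completes B w [Slot]"
proof -
  have "p \<noteq> []" if "apply_word w [Slot] = Some (map Entry p)" for p
    using length_entries_apply_word[OF that] that by (cases w) auto
  then show ?thesis
    by (auto simp: insertion_encodings_def is_insertion_encoding_def completes_def)
qed

lemma completes_append:
  "apply_word u c = Some d \<Longrightarrow> completes B (u @ v) c \<longleftrightarrow> completes B v d"
  by (simp add: completes_def apply_word_append)

lemma configuration_Slot: "configuration [Slot]"
  by (simp add: configuration_def is_perm_def)

text \<open>Every configuration met along a completing word is valid, and a slot number never
  exceeds the number of slots. This makes the alphabet finite.\<close>

lemma completes_slot_index:
  assumes k: "\<forall>c. valid B c \<longrightarrow> num_slots c \<le> k"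
  shows "configuration c \<Longrightarrow> completes B w c \<Longrightarrow> x \<in> set w \<Longrightarrow> slot_index x \<le> k"
proof (induction w arbitrary: c)
  case (Cons y w)
  obtain d where d: "insert_max y c = Some d"
    using Cons.prems(2) by (cases "insert_max y c") (auto simp: completes_def)
  then have "completes B w d" using Cons.prems(2) by (simp add: completes_def)
  moreover have "slot_index y \<le> num_slots c" using d by (auto simp: insert_max_eq_Some_iff)
  moreover have "num_slots c \<le> k" using k Cons.prems by (auto simp: valid_def)
  ultimately show ?case
    using Cons.IH[OF configuration_insert_max[OF d Cons.prems(1)]] Cons.prems(3) by auto
qed simp

lemma finite_slot_index: "finite {x. slot_index x \<le> k}"
proof (rule finite_subset)
  show "{x. slot_index x \<le> k} \<subseteq> Middle ` {..k} \<union> Left ` {..k} \<union> Right ` {..k} \<union> Fill ` {..k}"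
  proof
    fix x assume "x \<in> {x. slot_index x \<le> k}"
    then show "x \<in> Middle ` {..k} \<union> Left ` {..k} \<union> Right ` {..k} \<union> Fill ` {..k}"
      by (cases x) auto
  qed
qed simp

lemma finite_short_configurations: "finite {c. configuration c \<and> length c < N}"
proof (rule finite_subset)
  show "{c. configuration c \<and> length c < N} \<subseteq>
      {c. set c \<subseteq> insert Slot (Entry ` {1..N}) \<and> length c \<le> N}"
  proof safe
    fix c x assume c: "configuration c" "length c < N" "x \<in> set c" "x \<notin> Entry ` {1..N}"
    show "x = Slot"
    proof (cases x)
      case (Entry a)
      then have "a \<in> set (entries c)" using c by simp
      then have "a \<in> {1..length (entries c)}" using c(1) by (simp only: configuration_def is_perm_def)
      then show ?thesis using c Entry length_eq_entries_slots[of c] by auto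
    qed
  qed simp
qed (rule finite_lists_length_le, simp)

text \<open>The quotient by \<open>u\<close> consists of the words completing the configuration that
  \<open>u\<close> produces. It is empty if this is undefined or invalid, and otherwise agrees with
  that of one of the finitely many short configurations.\<close>

lemma reducible_imp_regular:
  assumes N: "\<forall>c. valid B c \<and> length c \<ge> N \<longrightarrow> (\<exists>i. IE_reducible B c i)"
  shows "regular (insertion_encodings B)"
proof (rule regular_if_finite_quotients[OF finite_slot_index])
  have k: "\<forall>c. valid B c \<longrightarrow> num_slots c \<le> N" using reducible_imp_bounded_slots[OF N] by blast
  show "insertion_encodings B \<subseteq> lists {x. slot_index x \<le> N}"
    using completes_slot_index[OF k configuration_Slot] by (auto simp: in_insertion_encodings_iff)
  have "{v. u @ v \<in> insertion_encodings B} \<in>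
      insert {} ((\<lambda>d. {v. completes B v d}) ` {d. configuration d \<and> length d < N})" for u
  proof (cases "apply_word u [Slot]")
    case None
    then show ?thesis by (simp add: in_insertion_encodings_iff completes_def apply_word_append)
  next
    case (Some c)
    have c: "configuration c" using configuration_apply_word[OF Some configuration_Slot] .
    have eq: "{v. u @ v \<in> insertion_encodings B} = {v. completes B v c}"
      by (simp add: in_insertion_encodings_iff completes_append[OF Some])
    show ?thesis
    proof (cases "valid B c")
      case True
      then obtain d where "valid B d" "length d < N" "indistinguishable B c d"
        using short_representative[OF N] by blast
      then show ?thesis
        unfolding eq by (auto simp: valid_def indistinguishable_def distinguishes_def)
    qed (use c eq in \<open>simp add: valid_def\<close>)
  qed
  then show "finite (range (\<lambda>u. {v. u @ v \<in> insertion_encodings B}))"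
    by (intro finite_subset[OF _ finite.insertI[OF finite_imageI[OF finite_short_configurations]]]) blast
qed

text \<open>Each insertion fills at most one slot, so a configuration with many slots has only long
  completions, whereas a finite automaton provides short ones.\<close>

lemma regular_imp_bounded_slots:
  assumes "regular (insertion_encodings B)"
  shows "\<exists>k. \<forall>c. valid B c \<longrightarrow> num_slots c \<le> k"
proof -
  obtain k where k: "\<And>u v. u @ v \<in> insertion_encodings B \<Longrightarrow>
      \<exists>v'. u @ v' \<in> insertion_encodings B \<and> length v' \<le> k"
    using regular_imp_bounded_completion[OF assms] by blast
  have "num_slots c \<le> k" if valid: "valid B c" for c
  proof (cases "c = []")
    case False
    obtain u where u: "apply_word u [Slot] = Some c"
      using configuration_reachable False valid by (auto simp: valid_def)
    obtain v where "completes B v c" using valid by (auto simp: valid_def)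
    then have "u @ v \<in> insertion_encodings B"
      by (simp add: in_insertion_encodings_iff completes_append[OF u])
    then obtain v' where v': "completes B v' c" "length v' \<le> k"
      using k[of u v] by (auto simp: in_insertion_encodings_iff completes_append[OF u])
    then obtain p where "apply_word v' c = Some (map Entry p)" by (auto simp: completes_def)
    then show ?thesis using num_slots_apply_word v'(2) by fastforce
  qed simp
  then show ?thesis by blast
qed

theorem theorem2:
  fixes B :: "nat list set"
  assumes "finite B" and "\<forall>\<beta>\<in>B. is_perm \<beta>"
  shows
    "(finite {p \<in> Av B. vertical_alternation p}
        \<longleftrightarrow> (\<exists>k. \<forall>c. valid B c \<longrightarrow> num_slots c \<le> k)) \<and>
     ((\<exists>k. \<forall>c. valid B c \<longrightarrow> num_slots c \<le> k)
        \<longleftrightarrow> (\<exists>N. \<forall>c. valid B c \<and> length c \<ge> N \<longrightarrow> (\<exists>i. IE_reducible B c i))) \<and>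
     ((\<exists>N. \<forall>c. valid B c \<and> length c \<ge> N \<longrightarrow> (\<exists>i. IE_reducible B c i))
        \<longleftrightarrow> regular (insertion_encodings B))"
  using finite_alternations_imp_bounded_slots[of B] bounded_slots_imp_finite_alternations[of B]
    bounded_slots_imp_reducible[OF assms(1)] reducible_imp_bounded_slots[of B]
    reducible_imp_regular[of B] regular_imp_bounded_slots[of B]
  by meson

end
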